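(* Let $m,n\in\mathbb{N}$, let $\mu$ be a $(C,\gamma)$-absolutely decaying measure on $\mathbb{R}^n$ with $K=\operatorname{supp}\mu$, and let $0<\alpha<\frac{1}{2C^{1/\gamma}+1}$. Then for every uniformly discrete sequence $\mathcal Z=(Z_k)_{k\in\mathbb{N}}$ of subsets of $\mathbb{R}^m$ and every lacunary sequence $\mathcal M=(M_k)_{k\in\mathbb{N}}$ of real $m\times n$ matrices, the set $$\tilde E(\mathcal M,\mathcal Z)=\{\mathbf{x}\in\mathbb{R}^n:\ \inf_{k\in\mathbb{N}} d(M_k\mathbf{x},Z_k)>0\}$$ is $\alpha$-winning on $K$.
   Context: $d$ denotes Euclidean distance; $d(\mathbf{v},Z)=\inf_{\mathbf{z}\in Z}d(\mathbf{v},\mathbf{z})$. For a closed set $K\subset\mathbb{R}^n$ and $0<\alpha,\beta<1$, Schmidt's $(\alpha,\beta)$-game on $K$ with target set $S$ is played as follows: balls are $B(\mathbf{x},\rho)=\{\mathbf{x}'\in K: d(\mathbf{x},\mathbf{x}')\le\rho\}$ with $\mathbf{x}\in K$, $\rho>0$, and $(\mathbf{x}_2,\rho_2)\le_s(\mathbf{x}_1,\rho_1)$ means $\rho_2+d(\mathbf{x}_1,\mathbf{x}_2)\le\rho_1$. Bob picks $\omega_1=(\mathbf{x}_1,\rho_1)$ with $\mathbf{x}_1\in K$; then Alice and Bob alternately pick $\omega_k'=(\mathbf{x}_k',\rho_k')\le_s\omega_k$ and $\omega_{k+1}=(\mathbf{x}_{k+1},\rho_{k+1})\le_s\omega_k'$,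 all centers in $K$, with $\rho_k'=\alpha\rho_k$ and $\rho_{k+1}=\beta\rho_k'$. The nested balls intersect in a single point $\mathbf{x}_\infty$; Alice wins if $\mathbf{x}_\infty\in S$. A set $S\subset\mathbb{R}^n$ is $(\alpha,\beta)$-winning on $K$ if Alice has a strategy guaranteeing $\mathbf{x}_\infty\in S\cap K$ whatever Bob does, and $\alpha$-winning on $K$ if it is $(\alpha,\beta)$-winning on $K$ for every $\beta\in(0,1)$. A locally finite Borel measure $\mu$ on $\mathbb{R}^n$ is $(C,\gamma)$-absolutely decaying ($C,\gamma>0$) if there is $\rho_0>0$ such that $\mu(B(\mathbf{x},\rho)\cap\mathcal L^{(\varepsilon)})<C(\varepsilon/\rho)^\gamma\mu(B(\mathbf{x},\rho))$ for every affine hyperplane $\mathcal L\subset\mathbb{R}^n$, every $\mathbf{x}\in\operatorname{supp}\mu$, every $0<\rho<\rho_0$ and every $\varepsilon>0$; here $B(\mathbf{x},\rho)$ is the closed Euclidean ball and $\mathcal L^{(\varepsilon)}=\{\mathbf{x}:d(\mathbf{x},\mathcal L)\le\varepsilon\}$. A sequence $(M_k)$ of nonzero matrices is lacunary if $\inf_k \|M_{k+1}\|_{op}/\|M_k\|_{op}>1$. A set $Z\subset\mathbb{R}^m$ is $\delta$-uniformly discrete if $\inf_{\mathbf{x}\ne\mathbf{y}\in Z}d(\mathbf{x},\mathbf{y})>\delta$; a sequence $(Z_k)$ is uniformly discrete if for some $\delta>0$ every $Z_k$ is $\delta$-uniformly discrete. *)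

theory Defs
  imports "HOL-Analysis.Analysis"
begin

text \<open>A ball is represented by a pair (centre, radius).
  (x2,r2) \<le>_s (x1,r1) means r2 + d(x1,x2) \<le> r1.\<close>
definition ball_le :: "('a::metric_space \<times> real) \<Rightarrow> ('a \<times> real) \<Rightarrow> bool" where
  "ball_le w2 w1 \<longleftrightarrow> snd w2 + dist (fst w1) (fst w2) \<le> snd w1"

text \<open>Alice's strategy A maps Bob's history [w_1,...,w_k] to her move w_k'.
  Alice's k-th move (0-indexed) for Bob's play b.\<close>
definition alice_move :: "(('a \<times> real) list \<Rightarrow> ('a \<times> real)) \<Rightarrow> (nat \<Rightarrow> 'a \<times> real) \<Rightarrow> nat \<Rightarrow> 'a \<times> real" where
  "alice_move A b k = A (map b [0..<Suc k])"

definition bob_legal_upto :: "real \<Rightarrow> 'a::metric_space set \<Rightarrow> (('a \<times> real) list \<Rightarrow> ('a \<times> real))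
    \<Rightarrow> (nat \<Rightarrow> 'a \<times> real) \<Rightarrow> nat \<Rightarrow> bool" where
  "bob_legal_upto \<beta> K A b k \<longleftrightarrow>
     fst (b 0) \<in> K \<and> snd (b 0) > 0 \<and>
     (\<forall>j<k. fst (b (Suc j)) \<in> K \<and> snd (b (Suc j)) = \<beta> * snd (alice_move A b j)
            \<and> ball_le (b (Suc j)) (alice_move A b j))"

definition alice_legal :: "real \<Rightarrow> 'a::metric_space set \<Rightarrow> ('a \<times> real) \<Rightarrow> ('a \<times> real) \<Rightarrow> bool" where
  "alice_legal \<alpha> K w w' \<longleftrightarrow> fst w' \<in> K \<and> snd w' = \<alpha> * snd w \<and> ball_le w' w"

text \<open>S is (alpha,beta)-winning on K: Alice has a strategy which always yields legal moves
  (as long as Bob has played legally) and such that, for every legal play of Bob, the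
  point of intersection of the nested balls B(x_k,rho_k) = {x' in K. d(x_k,x') \<le> rho_k}
  lies in S (and in K).\<close>
definition ab_winning :: "real \<Rightarrow> real \<Rightarrow> 'a::metric_space set \<Rightarrow> 'a set \<Rightarrow> bool" where
  "ab_winning \<alpha> \<beta> K S \<longleftrightarrow>
     (\<exists>A. \<forall>b.
        (\<forall>k. bob_legal_upto \<beta> K A b k \<longrightarrow> alice_legal \<alpha> K (b k) (alice_move A b k)) \<and>
        ((\<forall>k. bob_legal_upto \<beta> K A b k) \<longrightarrow>
           (\<forall>y. (\<forall>k. y \<in> K \<and> dist (fst (b k)) y \<le> snd (b k)) \<longrightarrow> y \<in> S)))"

definition alpha_winning :: "real \<Rightarrow> 'a::metric_space set \<Rightarrow> 'a set \<Rightarrow> bool" where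
  "alpha_winning \<alpha> K S \<longleftrightarrow> (\<forall>\<beta>. 0 < \<beta> \<and> \<beta> < 1 \<longrightarrow> ab_winning \<alpha> \<beta> K S)"

definition locally_finite_borel :: "'a::euclidean_space measure \<Rightarrow> bool" where
  "locally_finite_borel \<mu> \<longleftrightarrow> sets \<mu> = sets borel \<and>
     (\<forall>x. \<exists>r>0. emeasure \<mu> (ball x r) < \<infinity>)"

definition msupp :: "'a::euclidean_space measure \<Rightarrow> 'a set" where
  "msupp \<mu> = {x. \<forall>r>0. emeasure \<mu> (ball x r) > 0}"

definition affine_hyperplane :: "'a::euclidean_space set \<Rightarrow> bool" where
  "affine_hyperplane L \<longleftrightarrow> (\<exists>a b. a \<noteq> 0 \<and> L = {y. a \<bullet> y = b})"

definition nbhd :: "'a::euclidean_space set \<Rightarrow> real \<Rightarrow> 'a set" where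
  "nbhd L \<epsilon> = {y. infdist y L \<le> \<epsilon>}"

definition absolutely_decaying :: "real \<Rightarrow> real \<Rightarrow> 'a::euclidean_space measure \<Rightarrow> bool" where
  "absolutely_decaying C \<gamma> \<mu> \<longleftrightarrow> C > 0 \<and> \<gamma> > 0 \<and> locally_finite_borel \<mu> \<and>
     (\<exists>\<rho>0>0. \<forall>L x \<rho> \<epsilon>. affine_hyperplane L \<and> x \<in> msupp \<mu> \<and> 0 < \<rho> \<and> \<rho> < \<rho>0 \<and> 0 < \<epsilon> \<longrightarrow>
        emeasure \<mu> (cball x \<rho> \<inter> nbhd L \<epsilon>) < ennreal (C * (\<epsilon> / \<rho>) powr \<gamma>) * emeasure \<mu> (cball x \<rho>))"

definition lacunary :: "(nat \<Rightarrow> real^'n^'m) \<Rightarrow> bool" where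
  "lacunary M \<longleftrightarrow> (\<forall>k. M k \<noteq> 0) \<and>
     (\<exists>q>1. \<forall>k. onorm (\<lambda>x. M (Suc k) *v x) \<ge> q * onorm (\<lambda>x. M k *v x))"

definition uniformly_discrete_seq :: "(nat \<Rightarrow> 'a::metric_space set) \<Rightarrow> bool" where
  "uniformly_discrete_seq Z \<longleftrightarrow> (\<exists>\<delta>>0. \<forall>k. \<forall>x\<in>Z k. \<forall>y\<in>Z k. x \<noteq> y \<longrightarrow> dist x y > \<delta>)"

text \<open>inf_k d(M_k x, Z_k) > 0, with d(v, {}) = +infinity.\<close>
definition E_tilde :: "(nat \<Rightarrow> real^'n^'m) \<Rightarrow> (nat \<Rightarrow> (real^'m) set) \<Rightarrow> (real^'n) set" where
  "E_tilde M Z = {x. \<exists>\<epsilon>>0. \<forall>k. \<forall>z\<in>Z k. dist (M k *v x) z \<ge> \<epsilon>}"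

end

theory Submission
  imports Defs
begin

text \<open>Write \<open>t k\<close> for the operator norm of \<open>M k\<close>. On a ball of radius \<open>\<rho>\<close> with \<open>t k * \<rho>\<close> small
  compared to the separation of the sets \<open>Z k\<close>, points \<open>x\<close> with \<open>M k x\<close> close to \<open>Z k\<close> lie near a
  single hyperplane. Absolute decay, averaged over the ball, gives Alice a move that stays away
  from weighted hyperplanes carrying a fixed proportion \<open>1 - \<eta>\<close> of the total weight. With the
  weights \<open>t k powr - s\<close>, where \<open>s > 0\<close> is so small that \<open>\<eta> < (\<alpha> * \<beta>) powr s\<close>, the total weight of the
  indices still to be avoided stays bounded by a constant times \<open>\<rho> powr s\<close>: the indices that become
  relevant in one turn contribute only \<open>O(\<rho> powr s)\<close>, by lacunarity. Hence an index still to be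
  avoided has \<open>t k * \<rho>\<close> bounded below, so every index is dealt with at a scale \<open>\<rho>\<close> comparable
  to \<open>1 / t k\<close>, which gives a uniform lower bound for the distance of \<open>M k x\<close> to \<open>Z k\<close>.\<close>

section \<open>The support of a measure and finiteness on compact sets\<close>

text \<open>The complement of the support is a union of null balls, and by Lindelof countably many
  of them already cover it. This lets an averaging argument over a ball produce a point of the
  support, which is where Alice must place her centre.\<close>

lemma null_sets_compl_msupp:
  fixes \<mu> :: "'a::euclidean_space measure"
  assumes "sets \<mu> = sets borel"
  shows "- msupp \<mu> \<in> null_sets \<mu>"
proof -
  define \<B> where "\<B> = {ball x r | x r. 0 < r \<and> emeasure \<mu> (ball x r) = 0}"
  have "\<And>S. S \<in> \<B> \<Longrightarrow> open S"
    unfolding \<B>_def by auto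
  then obtain \<C> where \<C>: "\<C> \<subseteq> \<B>" "countable \<C>" "\<Union>\<C> = \<Union>\<B>"
    using Lindelof[of \<B>] by metis
  have "\<Union>\<C> \<in> null_sets \<mu>"
  proof (intro null_sets_UN'[of \<C> "\<lambda>S. S", simplified] \<C>)
    fix S assume "S \<in> \<C>"
    then show "S \<in> null_sets \<mu>"
      using \<C>(1) assms unfolding \<B>_def null_sets_def by auto
  qed
  moreover have "- msupp \<mu> = \<Union>\<B>"
  proof
    show "- msupp \<mu> \<subseteq> \<Union>\<B>"
    proof
      fix x assume "x \<in> - msupp \<mu>"
      then obtain r where "0 < r" "emeasure \<mu> (ball x r) = 0"
        by (auto simp: msupp_def)
      then show "x \<in> \<Union>\<B>"
        unfolding \<B>_def by (intro UnionI[of "ball x r"]) auto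
    qed
    show "\<Union>\<B> \<subseteq> - msupp \<mu>"
    proof
      fix y assume "y \<in> \<Union>\<B>"
      then obtain x r where xr: "0 < r" "emeasure \<mu> (ball x r) = 0" "y \<in> ball x r"
        unfolding \<B>_def by auto
      have "emeasure \<mu> (ball y (r - dist x y)) \<le> emeasure \<mu> (ball x r)"
        using assms by (intro emeasure_mono) (auto, smt (verit) dist_triangle)
      then show "y \<in> - msupp \<mu>"
        using xr unfolding msupp_def by (auto intro!: exI[of _ "r - dist x y"])
    qed
  qed
  ultimately show ?thesis
    using \<C>(3) by simp
qed

lemma emeasure_compact_finite:
  fixes \<mu> :: "'a::euclidean_space measure"
  assumes "locally_finite_borel \<mu>" "compact S"
  shows "emeasure \<mu> S < \<infinity>"
proof -
  obtain r where r: "\<And>x. r x > (0::real)" "\<And>x. emeasure \<mu> (ball x (r x)) < \<infinity>"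
    using assms(1) unfolding locally_finite_borel_def by metis
  have sets: "sets \<mu> = sets borel"
    using assms(1) unfolding locally_finite_borel_def by simp
  have "S \<subseteq> (\<Union>x\<in>S. ball x (r x))"
    using r(1) by auto
  then obtain T where T: "finite T" "S \<subseteq> (\<Union>x\<in>T. ball x (r x))"
    using compactE_image[OF assms(2), of S "\<lambda>x. ball x (r x)"] by (metis open_ball)
  have "emeasure \<mu> S \<le> emeasure \<mu> (\<Union>x\<in>T. ball x (r x))"
    using T sets by (intro emeasure_mono) auto
  also have "\<dots> \<le> (\<Sum>x\<in>T. emeasure \<mu> (ball x (r x)))"
    using T sets by (intro emeasure_subadditive_finite) auto
  also have "\<dots> < \<infinity>"
    using T r(2) by (simp add: less_top)
  finally show ?thesis .
qed

section \<open>Avoiding weighted hyperplanes by averaging\<close>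

lemma infdist_hyperplane_le:
  fixes a y :: "'a::euclidean_space"
  assumes "a \<noteq> 0"
  shows "infdist y {u. a \<bullet> u = b} \<le> \<bar>a \<bullet> y - b\<bar> / norm a"
proof -
  define p where "p = y - ((a \<bullet> y - b) / (a \<bullet> a)) *\<^sub>R a"
  have "a \<bullet> p = b"
    using assms by (simp add: p_def inner_diff_right)
  then have "infdist y {u. a \<bullet> u = b} \<le> dist y p"
    by (intro infdist_le) simp
  also have "\<dots> = \<bar>a \<bullet> y - b\<bar> / norm a"
    using assms by (simp add: p_def dist_norm norm_eq_sqrt_inner[symmetric] power2_norm_eq_inner[symmetric] power2_eq_square)
  finally show ?thesis .
qed

text \<open>Each slab takes up less than a fraction \<eta> of the measure of the ball of radius
  \<open>(1 - \<alpha>) * \<rho>\<close>, so the average over this ball of the weight of the slabs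
  containing a point is at most \<eta> times the total, and some point of the support does no worse
  than average. The radius \<open>(1 - \<alpha>) * \<rho>\<close> leaves room for Alice's ball of
  radius \<open>\<alpha> * \<rho>\<close>. The half-width \<open>2 * \<alpha> * \<rho>\<close> pays
  once for that radius and once for the distance to be kept from the hyperplane.\<close>

lemma absolutely_decaying_avoid_hyperplanes:
  fixes \<mu> :: "'a::euclidean_space measure"
  assumes dec: "absolutely_decaying C \<gamma> \<mu>"
    and \<alpha>: "0 < \<alpha>" "\<alpha> < 1 / (2 * C powr (1 / \<gamma>) + 1)"
  obtains \<eta> R :: real where "0 < \<eta>" "\<eta> < 1" "0 < R"
    and "\<forall>x\<in>msupp \<mu>. \<forall>\<rho> (F :: nat set) w a b.
          0 < \<rho> \<and> \<rho> < R \<and> finite F \<and> (\<forall>i\<in>F. a i \<noteq> 0) \<and> (\<forall>i\<in>F. 0 < w i) \<longrightarrow>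
          (\<exists>y\<in>msupp \<mu>. dist x y \<le> (1 - \<alpha>) * \<rho> \<and>
            (\<Sum>i | i \<in> F \<and> \<bar>a i \<bullet> y - b i\<bar> \<le> 2 * \<alpha> * \<rho> * norm (a i). w i) \<le> \<eta> * (\<Sum>i\<in>F. w i))"
proof -
  obtain R where C: "C > 0" "\<gamma> > 0" and lf: "locally_finite_borel \<mu>" and R: "R > 0"
    and decay: "\<And>L x \<rho> \<epsilon>. \<lbrakk>affine_hyperplane L; x \<in> msupp \<mu>; 0 < \<rho>; \<rho> < R; 0 < \<epsilon>\<rbrakk> \<Longrightarrow>
        emeasure \<mu> (cball x \<rho> \<inter> nbhd L \<epsilon>) < ennreal (C * (\<epsilon> / \<rho>) powr \<gamma>) * emeasure \<mu> (cball x \<rho>)"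
    using dec unfolding absolutely_decaying_def by blast
  have sets[simp, measurable_cong]: "sets \<mu> = sets borel"
    using lf unfolding locally_finite_borel_def by simp
  \<comment> \<open>This is the decay bound for the ratio of slab half-width
    \<open>2 * \<alpha> * \<rho>\<close> to ball radius \<open>(1 - \<alpha>) * \<rho>\<close>. The
    upper bound on \<alpha> is equivalent to \<eta> < 1.\<close>
  define \<eta> where "\<eta> = C * (2 * \<alpha> / (1 - \<alpha>)) powr \<gamma>"
  have pos: "C powr (1 / \<gamma>) > 0"
    using C by simp
  have lt: "\<alpha> * (2 * C powr (1 / \<gamma>) + 1) < 1"
    using \<alpha> pos by (simp add: field_simps)
  then have \<alpha>1: "\<alpha> < 1"
    using \<alpha>(1) pos by (smt (verit) mult_pos_pos distrib_left mult_cancel_left1)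
  have \<eta>0: "0 < \<eta>"
    using C \<alpha> \<alpha>1 by (simp add: \<eta>_def)
  have "2 * \<alpha> / (1 - \<alpha>) < 1 / C powr (1 / \<gamma>)"
    using lt \<alpha>1 pos by (simp add: field_simps)
  then have "(2 * \<alpha> / (1 - \<alpha>)) powr \<gamma> < (1 / C powr (1 / \<gamma>)) powr \<gamma>"
    using C \<alpha> \<alpha>1 by (intro powr_less_mono2) auto
  also have "\<dots> = 1 / C"
    using C by (simp add: powr_divide powr_powr)
  finally have \<eta>1: "\<eta> < 1"
    using C by (simp add: \<eta>_def field_simps)
  show thesis
  proof (rule that[OF \<eta>0 \<eta>1 R], intro ballI allI impI, elim conjE)
    fix x :: 'a and \<rho> :: real and F :: "nat set" and w :: "nat \<Rightarrow> real" and a :: "nat \<Rightarrow> 'a" and b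
    assume x: "x \<in> msupp \<mu>" and \<rho>: "0 < \<rho>" "\<rho> < R" and F: "finite F"
      and "\<forall>i\<in>F. a i \<noteq> 0" "\<forall>i\<in>F. 0 < w i"
    then have a: "\<And>i. i \<in> F \<Longrightarrow> a i \<noteq> 0" and w: "\<And>i. i \<in> F \<Longrightarrow> 0 < w i"
      by auto
    define B where "B = cball x ((1 - \<alpha>) * \<rho>)"
    define N where "N i = nbhd {u. a i \<bullet> u = b i} (2 * \<alpha> * \<rho>)" for i
    define W where "W = (\<Sum>i\<in>F. w i)"
    have \<rho>': "0 < (1 - \<alpha>) * \<rho>" "(1 - \<alpha>) * \<rho> < R"
      using \<rho> \<alpha>1 \<alpha>(1) by (auto intro: le_less_trans[OF mult_right_mono[of "1 - \<alpha>" 1 \<rho>]])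
    have [measurable]: "N i \<in> sets borel" "B \<in> sets borel" for i
      unfolding N_def nbhd_def B_def by (auto intro!: borel_closed closed_Collect_le continuous_intros)
    have Bfin: "emeasure \<mu> B < \<infinity>"
      unfolding B_def by (rule emeasure_compact_finite[OF lf compact_cball])
    have meas: "emeasure \<mu> (B \<inter> N i) < ennreal \<eta> * emeasure \<mu> B" if "i \<in> F" for i
    proof -
      have "2 * \<alpha> * \<rho> / ((1 - \<alpha>) * \<rho>) = 2 * \<alpha> / (1 - \<alpha>)"
        using \<rho> by simp
      then show ?thesis
        using decay[of "{u. a i \<bullet> u = b i}" x "(1 - \<alpha>) * \<rho>" "2 * \<alpha> * \<rho>"] a[OF that] x \<rho> \<alpha> \<rho>'
        by (auto simp: affine_hyperplane_def B_def N_def \<eta>_def)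
    qed
    have "\<exists>y\<in>msupp \<mu> \<inter> B. (\<Sum>i\<in>F. w i * indicator (N i) y) \<le> \<eta> * W"
    proof (rule ccontr)
      assume "\<not> ?thesis"
      then have big: "\<And>y. y \<in> msupp \<mu> \<Longrightarrow> y \<in> B \<Longrightarrow> \<eta> * W < (\<Sum>i\<in>F. w i * indicator (N i) y)"
        by force
      \<comment> \<open>For empty \<open>F\<close> both sides of \<open>big\<close> at the centre
        \<open>x\<close> would be 0. Nonemptiness makes the termwise strict inequality below strict
        for the sums.\<close>
      have F0: "F \<noteq> {}"
        using big[OF x] \<rho>' by (auto simp: B_def W_def)
      have "ennreal (\<eta> * W) * emeasure \<mu> B = (\<integral>\<^sup>+y. ennreal (\<eta> * W) * indicator B y \<partial>\<mu>)"
        by (simp add: nn_integral_cmult_indicator)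
      also have "\<dots> \<le> (\<integral>\<^sup>+y. (\<Sum>i\<in>F. ennreal (w i) * indicator (B \<inter> N i) y) \<partial>\<mu>)"
      proof (rule nn_integral_mono_AE)
        \<comment> \<open>The assumed lower bound concerns support points only, hence holds almost
          everywhere.\<close>
        have "ennreal (\<eta> * W) * indicator B y \<le> (\<Sum>i\<in>F. ennreal (w i) * indicator (B \<inter> N i) y)"
          if y: "y \<in> msupp \<mu>" for y
        proof (cases "y \<in> B")
          case True
          have "ennreal (\<eta> * W) \<le> ennreal (\<Sum>i\<in>F. w i * indicator (N i) y)"
            using big[OF y True] by (intro ennreal_leI) simp
          also have "\<dots> = (\<Sum>i\<in>F. ennreal (w i * indicator (N i) y))"
            using w by (subst sum_ennreal) (auto simp: less_imp_le)
          also have "\<dots> = (\<Sum>i\<in>F. ennreal (w i) * indicator (B \<inter> N i) y)"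
            using True by (intro sum.cong) (auto simp: indicator_def)
          finally show ?thesis
            using True by simp
        qed simp
        then show "AE y in \<mu>. ennreal (\<eta> * W) * indicator B y \<le> (\<Sum>i\<in>F. ennreal (w i) * indicator (B \<inter> N i) y)"
          using null_sets_compl_msupp[OF sets] by (intro AE_I'[of "- msupp \<mu>"]) auto
      qed
      also have "\<dots> = (\<Sum>i\<in>F. ennreal (w i) * emeasure \<mu> (B \<inter> N i))"
        by (subst nn_integral_sum) (auto simp: nn_integral_cmult_indicator)
      also have "\<dots> = ennreal (\<Sum>i\<in>F. w i * measure \<mu> (B \<inter> N i))"
      proof -
        have "emeasure \<mu> (B \<inter> N i) = ennreal (measure \<mu> (B \<inter> N i))" for i
          using le_less_trans[OF emeasure_mono[of "B \<inter> N i" B \<mu>] Bfin]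
          by (intro emeasure_eq_ennreal_measure) auto
        then have "(\<Sum>i\<in>F. ennreal (w i) * emeasure \<mu> (B \<inter> N i))
            = (\<Sum>i\<in>F. ennreal (w i * measure \<mu> (B \<inter> N i)))"
          using w by (intro sum.cong) (auto simp: ennreal_mult less_imp_le)
        also have "\<dots> = ennreal (\<Sum>i\<in>F. w i * measure \<mu> (B \<inter> N i))"
          using w by (intro sum_ennreal) (auto simp: less_imp_le)
        finally show ?thesis .
      qed
      finally have "ennreal (\<eta> * W * measure \<mu> B) \<le> ennreal (\<Sum>i\<in>F. w i * measure \<mu> (B \<inter> N i))"
        using Bfin w \<eta>0 by (simp add: emeasure_eq_ennreal_measure ennreal_mult W_def sum_nonneg less_imp_le)
      then have "\<eta> * W * measure \<mu> B \<le> (\<Sum>i\<in>F. w i * measure \<mu> (B \<inter> N i))"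
        using w by (subst (asm) ennreal_le_iff) (auto intro!: sum_nonneg simp: less_imp_le)
      also have "\<dots> < (\<Sum>i\<in>F. w i * (\<eta> * measure \<mu> B))"
      proof (rule sum_strict_mono[OF F F0])
        fix i assume i: "i \<in> F"
        have "ennreal (measure \<mu> (B \<inter> N i)) < ennreal (\<eta> * measure \<mu> B)"
          using meas[OF i] Bfin \<eta>0 le_less_trans[OF emeasure_mono[of "B \<inter> N i" B \<mu>] Bfin]
          by (simp add: emeasure_eq_ennreal_measure ennreal_mult)
        then show "w i * measure \<mu> (B \<inter> N i) < w i * (\<eta> * measure \<mu> B)"
          using w[OF i] by (simp add: ennreal_less_iff)
      qed
      also have "\<dots> = \<eta> * W * measure \<mu> B"
        by (simp add: W_def sum_distrib_left sum_distrib_right mult_ac)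
      finally show False by simp
    qed
    then obtain y where y: "y \<in> msupp \<mu>" "y \<in> B" "(\<Sum>i\<in>F. w i * indicator (N i) y) \<le> \<eta> * W"
      by blast
    have "(\<Sum>i | i \<in> F \<and> \<bar>a i \<bullet> y - b i\<bar> \<le> 2 * \<alpha> * \<rho> * norm (a i). w i) \<le>
        (\<Sum>i | i \<in> F \<and> y \<in> N i. w i)"
    proof (rule sum_mono2)
      show "{i \<in> F. \<bar>a i \<bullet> y - b i\<bar> \<le> 2 * \<alpha> * \<rho> * norm (a i)} \<subseteq> {i \<in> F. y \<in> N i}"
      proof safe
        fix i assume i: "i \<in> F" "\<bar>a i \<bullet> y - b i\<bar> \<le> 2 * \<alpha> * \<rho> * norm (a i)"
        have "infdist y {u. a i \<bullet> u = b i} \<le> \<bar>a i \<bullet> y - b i\<bar> / norm (a i)"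
          by (rule infdist_hyperplane_le[OF a[OF i(1)]])
        also have "\<dots> \<le> 2 * \<alpha> * \<rho>"
          using i a[OF i(1)] by (simp add: field_simps)
        finally show "y \<in> N i"
          by (simp add: N_def nbhd_def)
      qed
    qed (use F w in \<open>auto simp: less_imp_le\<close>)
    also have "\<dots> = (\<Sum>i\<in>F. w i * indicator (N i) y)"
      using F by (intro sum.mono_neutral_cong_left) (auto simp: indicator_def)
    finally show "\<exists>y\<in>msupp \<mu>. dist x y \<le> (1 - \<alpha>) * \<rho> \<and>
        (\<Sum>i | i \<in> F \<and> \<bar>a i \<bullet> y - b i\<bar> \<le> 2 * \<alpha> * \<rho> * norm (a i). w i) \<le> \<eta> * (\<Sum>i\<in>F. w i)"
      using y by (auto simp: B_def W_def intro!: bexI[of _ y])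
  qed
qed

section \<open>Lacunary sums and operator norms\<close>

text \<open>From the least index \<open>m\<close> of \<open>F\<close> on, \<open>t (m + j)\<close>
  is at least \<open>q ^ j * T\<close>. Gaps in \<open>F\<close> are harmless: shifting by
  \<open>m\<close> is injective, so the sum is dominated by a full geometric series of ratio
  \<open>q powr - s\<close>.\<close>

lemma sum_lacunary_powr_le:
  fixes t :: "nat \<Rightarrow> real"
  assumes q: "1 < q" and t: "\<And>k. q * t k \<le> t (Suc k)" and s: "0 < s" and T: "0 < T"
    and F: "finite F" "\<And>k. k \<in> F \<Longrightarrow> T \<le> t k"
  shows "(\<Sum>k\<in>F. t k powr - s) \<le> T powr - s / (1 - q powr - s)"
proof -
  define r where "r = q powr - s"
  have r: "0 < r" "r < 1"
    using q s by (auto simp: r_def powr_less_one)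
  show ?thesis
  proof (cases "F = {}")
    case True
    then show ?thesis using r by (simp add: r_def)
  next
    case False
    define m where "m = Min F"
    have m: "m \<in> F" "\<And>k. k \<in> F \<Longrightarrow> m \<le> k"
      using False F by (auto simp: m_def)
    have grow: "q ^ j * T \<le> t (m + j)" for j
    proof (induction j)
      case (Suc j)
      have "q ^ Suc j * T \<le> q * t (m + j)"
        using Suc q by (simp add: mult.assoc)
      then show ?case
        using t[of "m + j"] by simp
    qed (use F(2)[OF m(1)] in simp)
    have "(\<Sum>k\<in>F. t k powr - s) \<le> (\<Sum>k\<in>F. T powr - s * r ^ (k - m))"
    proof (rule sum_mono)
      fix k assume k: "k \<in> F"
      have "t k powr - s \<le> (q ^ (k - m) * T) powr - s"
        using grow[of "k - m"] m(2)[OF k] q T s by (intro powr_mono2') auto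
      also have "\<dots> = T powr - s * r ^ (k - m)"
        using q T by (simp add: powr_mult r_def powr_realpow[symmetric] powr_powr mult.commute)
      finally show "t k powr - s \<le> T powr - s * r ^ (k - m)" .
    qed
    also have "\<dots> = T powr - s * (\<Sum>j\<in>(\<lambda>k. k - m) ` F. r ^ j)"
    proof -
      have "inj_on (\<lambda>k. k - m) F"
        using m(2) by (intro inj_onI) (metis le_add_diff_inverse2)
      then show ?thesis
        by (simp add: sum.reindex sum_distrib_left)
    qed
    also have "\<dots> \<le> T powr - s * (\<Sum>j. r ^ j)"
      using F r by (intro mult_left_mono sum_le_suminf) (auto intro: summable_geometric)
    also have "\<dots> = T powr - s / (1 - r)"
      using r by (simp add: suminf_geometric)
    finally show ?thesis
      by (simp add: r_def)
  qed
qed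

text \<open>Pairing with \<open>w\<close> turns a condition on \<open>A *v x\<close> into one on a
  single linear functional with normal \<open>w v* A\<close>, whose norm is still comparable to the
  operator norm. The vector \<open>w\<close> is the direction of \<open>A *v u\<close> for a
  \<open>u\<close> that is stretched by more than half the operator norm; this is the source of the
  factor 2.\<close>

lemma matrix_dual_vector:
  fixes A :: "real^'n^'m"
  assumes "A \<noteq> 0"
  obtains w where "norm w = 1" "onorm (\<lambda>x. A *v x) \<le> 2 * norm (w v* A)" "0 < onorm (\<lambda>x. A *v x)"
proof -
  have bl: "bounded_linear (\<lambda>x. A *v x)"
    by (rule matrix_vector_mul_bounded_linear)
  define t where "t = onorm (\<lambda>x. A *v x)"
  have t: "0 < t"
    using onorm_pos_lt[OF bl] assms by (auto simp: t_def matrix_eq[of A 0])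
  have "\<exists>u. t / 2 * norm u < norm (A *v u)"
  proof (rule ccontr)
    assume "\<not> ?thesis"
    then have "norm (A *v u) \<le> t / 2 * norm u" for u
      by (simp add: not_less)
    then have "t \<le> t / 2"
      unfolding t_def by (intro onorm_bound) (use t t_def in auto)
    then show False using t by simp
  qed
  then obtain u where u: "t / 2 * norm u < norm (A *v u)"
    by blast
  define w where "w = (1 / norm (A *v u)) *\<^sub>R (A *v u)"
  have Au: "0 < norm (A *v u)"
    using u t by (smt (verit) mult_nonneg_nonneg norm_ge_zero half_gt_zero)
  have u0: "0 < norm u"
    using Au by auto
  have "norm (A *v u) = w \<bullet> (A *v u)"
    using Au by (simp add: w_def power2_norm_eq_inner[symmetric] power2_eq_square)
  also have "\<dots> \<le> norm (w v* A) * norm u"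
    by (simp add: dot_lmul_matrix[symmetric] norm_cauchy_schwarz)
  finally have "t / 2 * norm u < norm (w v* A) * norm u"
    using u by simp
  then have "t \<le> 2 * norm (w v* A)"
    using u0 by simp
  moreover have "norm w = 1"
    using Au by (simp add: w_def)
  ultimately show thesis
    using that t unfolding t_def by blast
qed

section \<open>From an invariant to a winning strategy\<close>

text \<open>The strategy may depend on the radius of Bob's first ball, and otherwise only on
  his last one.\<close>
lemma ab_winning_by_invariant:
  fixes f :: "real \<Rightarrow> 'a::metric_space \<times> real \<Rightarrow> 'a \<times> real"
  assumes \<alpha>\<beta>: "0 < \<alpha>" "0 < \<beta>"
    and legal: "\<And>r w. fst w \<in> K \<Longrightarrow> 0 < snd w \<Longrightarrow> alice_legal \<alpha> K w (f r w)"
    and init: "\<And>x r. x \<in> K \<Longrightarrow> 0 < r \<Longrightarrow> I r (x, r)"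
    and step: "\<And>r w v. \<lbrakk>0 < r; fst w \<in> K; 0 < snd w; I r w; fst v \<in> K;
        snd v = \<alpha> * \<beta> * snd w; ball_le v (f r w)\<rbrakk> \<Longrightarrow> I r v"
    and win: "\<And>r b y. \<lbrakk>0 < r; \<And>k. I r (b k); \<And>k. snd (b k) = r * (\<alpha> * \<beta>) ^ k; y \<in> K;
        \<And>k. dist (fst (b k)) y \<le> snd (b k)\<rbrakk> \<Longrightarrow> y \<in> S"
  shows "ab_winning \<alpha> \<beta> K S"
proof -
  define A where "A h = f (snd (hd h)) (last h)" for h :: "('a \<times> real) list"
  have A: "alice_move A b k = f (snd (b 0)) (b k)" for b k
    by (simp add: alice_move_def A_def hd_map del: upt_Suc) (simp add: hd_append)
  \<comment> \<open>The stage \<open>k\<close> is fixed and the induction runs over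
    \<open>j \<le> k\<close>, because Alice's moves must be legal even when Bob has played legally
    only up to stage \<open>k\<close>.\<close>
  have inv: "fst (b j) \<in> K \<and> snd (b j) = snd (b 0) * (\<alpha> * \<beta>) ^ j \<and> I (snd (b 0)) (b j)"
    if b: "bob_legal_upto \<beta> K A b k" and "j \<le> k" for b k j
    using \<open>j \<le> k\<close>
  proof (induction j)
    case 0
    then show ?case
      using b init[of "fst (b 0)" "snd (b 0)"] by (simp add: bob_legal_upto_def)
  next
    case (Suc j)
    have r: "0 < snd (b 0)"
      using b by (simp add: bob_legal_upto_def)
    have j: "fst (b j) \<in> K" "snd (b j) = snd (b 0) * (\<alpha> * \<beta>) ^ j" "I (snd (b 0)) (b j)"
      using Suc by auto
    have pos: "0 < snd (b j)"
      using j(2) r \<alpha>\<beta> by simp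
    have v: "fst (b (Suc j)) \<in> K" "snd (b (Suc j)) = \<beta> * snd (f (snd (b 0)) (b j))"
        "ball_le (b (Suc j)) (f (snd (b 0)) (b j))"
      using b Suc.prems by (auto simp: bob_legal_upto_def A)
    have v2: "snd (b (Suc j)) = \<alpha> * \<beta> * snd (b j)"
      using v(2) legal[OF j(1) pos, of "snd (b 0)"] by (simp add: alice_legal_def)
    show ?case
      using step[OF r j(1) pos j(3) v(1) v2 v(3)] v(1) v2 j(2) by simp
  qed
  show ?thesis
    unfolding ab_winning_def
  proof (intro exI[of _ A] allI conjI impI)
    fix b k assume b: "bob_legal_upto \<beta> K A b k"
    then have "0 < snd (b k)"
      using inv[OF b order_refl] \<alpha>\<beta> by (simp add: bob_legal_upto_def)
    then show "alice_legal \<alpha> K (b k) (alice_move A b k)"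
      using inv[OF b order_refl] by (simp add: A legal)
  next
    fix b y assume b: "\<forall>k. bob_legal_upto \<beta> K A b k" and y: "\<forall>k. y \<in> K \<and> dist (fst (b k)) y \<le> snd (b k)"
    show "y \<in> S"
    proof (rule win[of "snd (b 0)" b])
      show "0 < snd (b 0)"
        using b by (simp add: bob_legal_upto_def)
      show "I (snd (b 0)) (b k)" "snd (b k) = snd (b 0) * (\<alpha> * \<beta>) ^ k" for k
        using inv[OF b[rule_format] order_refl, of k] by blast+
    qed (use y in auto)
  qed
qed

section \<open>The potential argument for the game\<close>

theorem theorem4p1:
  fixes \<mu> :: "(real^'n) measure" and C \<gamma> \<alpha> :: real
    and Z :: "nat \<Rightarrow> (real^'m) set" and M :: "nat \<Rightarrow> real^'n^'m"
  assumes "absolutely_decaying C \<gamma> \<mu>"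
    and "0 < \<alpha>" and "\<alpha> < 1 / (2 * C powr (1 / \<gamma>) + 1)"
    and "uniformly_discrete_seq Z"
    and "lacunary M"
  shows "alpha_winning \<alpha> (msupp \<mu>) (E_tilde M Z)"
  unfolding alpha_winning_def
proof (intro allI impI)
  fix \<beta> :: real assume \<beta>: "0 < \<beta> \<and> \<beta> < 1"
  define K where "K = msupp \<mu>"
  obtain \<eta> R :: real where \<eta>: "0 < \<eta>" "\<eta> < 1" and R: "0 < R"
    and avoid: "\<forall>x\<in>K. \<forall>\<rho> (F :: nat set) w a b.
          0 < \<rho> \<and> \<rho> < R \<and> finite F \<and> (\<forall>i\<in>F. a i \<noteq> 0) \<and> (\<forall>i\<in>F. 0 < w i) \<longrightarrow>
          (\<exists>y\<in>K. dist x y \<le> (1 - \<alpha>) * \<rho> \<and>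
            (\<Sum>i | i \<in> F \<and> \<bar>a i \<bullet> y - b i\<bar> \<le> 2 * \<alpha> * \<rho> * norm (a i). w i) \<le> \<eta> * (\<Sum>i\<in>F. w i))"
    using absolutely_decaying_avoid_hyperplanes[OF assms(1-3)] unfolding K_def by blast
  have \<alpha>: "0 < \<alpha>" "\<alpha> < 1"
  proof -
    have "1 / (2 * C powr (1 / \<gamma>) + 1) \<le> 1"
      using powr_ge_zero[of C "1 / \<gamma>"] by (subst divide_le_eq_1) linarith
    then show "\<alpha> < 1"
      using assms(3) by linarith
  qed (rule assms(2))
  obtain \<delta> where \<delta>: "0 < \<delta>" and disc: "\<And>k x y. x \<in> Z k \<Longrightarrow> y \<in> Z k \<Longrightarrow> dist x y \<le> \<delta> \<Longrightarrow> x = y"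
    using assms(4) unfolding uniformly_discrete_seq_def by (meson not_le)
  define t where "t k = onorm (\<lambda>x. M k *v x)" for k
  obtain q where q: "1 < q" and lac: "\<And>k. q * t k \<le> t (Suc k)" and M0: "\<And>k. M k \<noteq> 0"
    using assms(5) unfolding lacunary_def t_def by auto
  have "\<exists>u. norm u = 1 \<and> t k \<le> 2 * norm (u v* M k) \<and> 0 < t k" for k
    using matrix_dual_vector[OF M0[of k]] unfolding t_def by metis
  then obtain u where u: "\<And>k. norm (u k) = 1" and tu: "\<And>k. t k \<le> 2 * norm (u k v* M k)"
    and t0: "\<And>k. 0 < t k"
    by metis
  define a where "a k = u k v* M k" for k
  have a_ge: "t k \<le> 2 * norm (a k)" for k
    using tu by (simp add: a_def)
  have a0: "a k \<noteq> 0" for k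
    using a_ge[of k] t0[of k] by auto
  \<comment> \<open>If \<open>M k *v y\<close> is close to \<open>z\<close>, then \<open>y\<close>
    lies in a thin slab around the hyperplane with normal \<open>a k\<close> and offset
    \<open>u k \<bullet> z\<close>.\<close>
  have au: "\<bar>a k \<bullet> y - u k \<bullet> z\<bar> \<le> dist (M k *v y) z" for k y z
    using Cauchy_Schwarz_ineq2[of "u k" "M k *v y - z"] u[of k]
    by (simp add: a_def dot_lmul_matrix inner_diff_right dist_norm)
  have tM: "dist (M k *v x) (M k *v y) \<le> t k * dist x y" for k x y
    using onorm[OF matrix_vector_mul_bounded_linear, of "M k" "x - y"]
    by (simp add: t_def dist_norm matrix_vector_mult_diff_distrib)
  have t_exp: "q ^ k * t 0 \<le> t k" for k
  proof (induction k)
    case (Suc k)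
    then have "q ^ Suc k * t 0 \<le> q * t k"
      using q by (simp add: mult.assoc)
    then show ?case
      using lac[of k] by simp
  qed simp
  have t_ge: "t 0 \<le> t k" for k
    using t_exp[of k] q t0[of 0] by (smt (verit) mult_le_cancel_right1 one_le_power)
  \<comment> \<open>At a given radius only finitely many indices are in range, so the potential
    \<open>\<Psi>\<close> below is a finite sum.\<close>
  have t_fin: "finite {k. t k * \<rho> \<le> c}" if "0 < \<rho>" for \<rho> c
  proof -
    obtain n where n: "c / (\<rho> * t 0) < q ^ n"
      using real_arch_pow[OF q] by blast
    have "k < n" if k: "t k * \<rho> \<le> c" for k
    proof (rule ccontr)
      assume "\<not> k < n"
      then have "q ^ n * t 0 \<le> t k"
        using t_exp[of k] power_increasing[of n k q] q t0[of 0]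
        by (smt (verit) mult_right_mono not_less)
      then have "q ^ n * t 0 * \<rho> \<le> c"
        using k mult_right_mono[of "q ^ n * t 0" "t k" \<rho>] \<open>0 < \<rho>\<close> by linarith
      then show False
        using n \<open>0 < \<rho>\<close> t0[of 0] by (simp add: field_simps)
    qed
    then have "{k. t k * \<rho> \<le> c} \<subseteq> {..<n}"
      by auto
    then show ?thesis
      by (rule finite_subset) simp
  qed
  define \<theta> where "\<theta> = \<alpha> * \<beta>"
  have \<theta>: "0 < \<theta>" "\<theta> < 1"
    using \<alpha> \<beta> mult_strict_mono[of \<alpha> 1 \<beta> 1] by (auto simp: \<theta>_def)
  \<comment> \<open>With this exponent \<open>\<theta> powr s\<close> is the square root of \<eta>,
    hence larger than \<eta>: one turn shrinks the potential by more than it shrinks the power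
    \<open>\<rho> powr s\<close>.\<close>
  define s where "s = ln \<eta> / (2 * ln \<theta>)"
  have s: "0 < s"
    using \<eta> \<theta> by (simp add: s_def zero_less_divide_iff)
  have \<theta>s: "\<eta> < \<theta> powr s"
  proof -
    have "ln \<eta> < ln \<eta> / 2"
      using \<eta> by simp
    also have "\<dots> = s * ln \<theta>"
      using \<theta> by (simp add: s_def)
    finally have "exp (ln \<eta>) < exp (s * ln \<theta>)"
      by simp
    then show ?thesis
      using \<eta> \<theta> by (simp add: powr_def)
  qed
  define G where "G = 1 / (1 - q powr - s)"
  have G: "0 < G"
    using q s by (simp add: G_def powr_less_one)
  have sum_le: "(\<Sum>k\<in>F. t k powr - s) \<le> G * T powr - s"
    if "0 < T" "finite F" "\<And>k. k \<in> F \<Longrightarrow> T \<le> t k" for F T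
    using sum_lacunary_powr_le[where t = t, OF q lac s that] by (simp add: G_def)

  \<comment> \<open>The indices whose target \<open>Z k\<close> is not yet avoided by \<open>\<kappa>\<close> on the ball, among those for
    which the ball is so small that a single point of \<open>Z k\<close>, hence a single hyperplane, matters.\<close>
  define U where "U \<kappa> w = {k. t k * snd w \<le> \<delta> / 4 \<and>
      (\<exists>z\<in>Z k. \<exists>y\<in>cball (fst w) (snd w). dist (M k *v y) z < \<kappa>)}"
    for \<kappa> :: real and w :: "(real^'n) \<times> real"
  define \<Psi> where "\<Psi> \<kappa> w = (\<Sum>k\<in>U \<kappa> w. t k powr - s)" for \<kappa> w
  \<comment> \<open>These are the indices that the move \<open>w'\<close> fails to clear. The extra
    bound on \<kappa> says that being within \<kappa> of \<open>Z k\<close> costs at most half of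
    the slab half-width \<open>2 * \<alpha> * \<rho>\<close>.\<close>
  define V where "V \<kappa> w w' = {k \<in> U \<kappa> w. \<kappa> \<le> \<alpha> * snd w * norm (a k) \<and>
      (\<exists>z\<in>Z k. \<exists>y\<in>cball (fst w') (snd w'). dist (M k *v y) z < \<kappa>)}"
    for \<kappa> :: real and w w' :: "(real^'n) \<times> real"
  have U_fin: "finite (U \<kappa> w)" if "0 < snd w" for \<kappa> w
    using t_fin[OF that, of "\<delta> / 4"] by (rule rev_finite_subset) (auto simp: U_def)

  have move: "\<exists>w'. alice_legal \<alpha> K w w' \<and>
      (snd w < R \<longrightarrow> \<kappa> \<le> \<delta> / 4 \<longrightarrow> (\<Sum>k\<in>V \<kappa> w w'. t k powr - s) \<le> \<eta> * \<Psi> \<kappa> w)"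
    if w: "fst w \<in> K" "0 < snd w" for \<kappa> w
  proof (cases "snd w < R \<and> \<kappa> \<le> \<delta> / 4")
    \<comment> \<open>Nothing is claimed about the weights here, so the concentric ball serves as a
      legal move.\<close>
    case False
    then show ?thesis
      using w \<alpha> by (intro exI[of _ "(fst w, \<alpha> * snd w)"]) (auto simp: alice_legal_def ball_le_def)
  next
    case True
    define \<rho> where "\<rho> = snd w"
    have "\<exists>z. \<forall>k\<in>U \<kappa> w. z k \<in> Z k \<and> (\<exists>y\<in>cball (fst w) \<rho>. dist (M k *v y) (z k) < \<kappa>)"
      unfolding U_def \<rho>_def by (intro bchoice) auto
    then obtain z where z: "\<And>k. k \<in> U \<kappa> w \<Longrightarrow> z k \<in> Z k"
      "\<And>k. k \<in> U \<kappa> w \<Longrightarrow> \<exists>y\<in>cball (fst w) \<rho>. dist (M k *v y) (z k) < \<kappa>"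
      by blast
    \<comment> \<open>The two targets differ by less than \<kappa> + \<open>\<delta> / 2\<close> +
      \<kappa>, where the middle term bounds the diameter of the image of the ball and \<kappa> is
      at most \<open>\<delta> / 4\<close>. Separation makes them equal, so each index contributes a
      single hyperplane.\<close>
    have z_unique: "z' = z k"
      if k: "k \<in> U \<kappa> w" and z': "z' \<in> Z k" and y': "y' \<in> cball (fst w) \<rho>" "dist (M k *v y') z' < \<kappa>" for k z' y'
    proof (rule disc[OF z' z(1)[OF k]])
      obtain y where y: "y \<in> cball (fst w) \<rho>" "dist (M k *v y) (z k) < \<kappa>"
        using z(2)[OF k] by blast
      have "dist y' y \<le> 2 * \<rho>"
        using y y' dist_triangle2[of y' y "fst w"] by (auto simp: dist_commute)
      then have "t k * dist y' y \<le> t k * (2 * \<rho>)"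
        using t0[of k] by simp
      also have "\<dots> \<le> \<delta> / 2"
        using k by (simp add: U_def \<rho>_def)
      finally have "dist (M k *v y') (M k *v y) \<le> \<delta> / 2"
        using tM[of k y' y] by simp
      moreover have "dist z' (z k) \<le> dist (M k *v y') z' + dist (M k *v y') (M k *v y) + dist (M k *v y) (z k)"
        by (smt (verit) dist_triangle dist_commute)
      ultimately show "dist z' (z k) \<le> \<delta>"
        using y y' True by linarith
    qed
    obtain x' where x': "x' \<in> K" "dist (fst w) x' \<le> (1 - \<alpha>) * \<rho>"
      "(\<Sum>k | k \<in> U \<kappa> w \<and> \<bar>a k \<bullet> x' - u k \<bullet> z k\<bar> \<le> 2 * \<alpha> * \<rho> * norm (a k). t k powr - s) \<le> \<eta> * \<Psi> \<kappa> w"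
      using avoid[rule_format, of "fst w" \<rho> "U \<kappa> w" a "\<lambda>k. t k powr - s" "\<lambda>k. u k \<bullet> z k"] w True U_fin[OF w(2)] a0 less_imp_neq[OF t0]
      unfolding \<rho>_def \<Psi>_def by auto
    \<comment> \<open>If Alice's ball has a bad point \<open>y\<close>, then \<open>y\<close> is
      within \<open>\<alpha> * \<rho>\<close> of the hyperplane and the centre \<open>x'\<close>
      within \<open>\<alpha> * \<rho>\<close> of \<open>y\<close>, so \<open>x'\<close> lies in the
      slab of half-width \<open>2 * \<alpha> * \<rho>\<close>.\<close>
    have "(\<Sum>k\<in>V \<kappa> w (x', \<alpha> * \<rho>). t k powr - s) \<le>
      (\<Sum>k | k \<in> U \<kappa> w \<and> \<bar>a k \<bullet> x' - u k \<bullet> z k\<bar> \<le> 2 * \<alpha> * \<rho> * norm (a k). t k powr - s)"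
    proof (rule sum_mono2)
      show "V \<kappa> w (x', \<alpha> * \<rho>) \<subseteq> {k \<in> U \<kappa> w. \<bar>a k \<bullet> x' - u k \<bullet> z k\<bar> \<le> 2 * \<alpha> * \<rho> * norm (a k)}"
      proof
        fix k assume "k \<in> V \<kappa> w (x', \<alpha> * \<rho>)"
        then obtain z' y where k: "k \<in> U \<kappa> w" "\<kappa> \<le> \<alpha> * \<rho> * norm (a k)"
          and zy: "z' \<in> Z k" "dist x' y \<le> \<alpha> * \<rho>" "dist (M k *v y) z' < \<kappa>"
          unfolding V_def \<rho>_def by auto
        have "dist (fst w) y \<le> \<rho>"
          using dist_triangle[of "fst w" y x'] zy(2) x'(2) by (simp add: algebra_simps)
        then have "z' = z k"
          using z_unique[OF k(1) zy(1) _ zy(3)] by simp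
        then have "\<bar>a k \<bullet> y - u k \<bullet> z k\<bar> \<le> \<alpha> * \<rho> * norm (a k)"
          using au[of k y z'] zy(3) k(2) by simp
        moreover have "\<bar>a k \<bullet> x' - a k \<bullet> y\<bar> \<le> \<alpha> * \<rho> * norm (a k)"
        proof -
          have "\<bar>a k \<bullet> x' - a k \<bullet> y\<bar> \<le> norm (a k) * dist x' y"
            using Cauchy_Schwarz_ineq2[of "a k" "x' - y"] by (simp add: inner_diff_right dist_norm)
          also have "\<dots> \<le> norm (a k) * (\<alpha> * \<rho>)"
            using zy(2) by (intro mult_left_mono) auto
          finally show ?thesis by (simp add: mult_ac)
        qed
        ultimately show "k \<in> {k \<in> U \<kappa> w. \<bar>a k \<bullet> x' - u k \<bullet> z k\<bar> \<le> 2 * \<alpha> * \<rho> * norm (a k)}"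
          using k(1) by simp
      qed
    qed (use U_fin[OF w(2)] in auto)
    also note x'(3)
    finally show ?thesis
      using x'(1,2) by (intro exI[of _ "(x', \<alpha> * \<rho>)"]) (auto simp: alice_legal_def ball_le_def \<rho>_def algebra_simps)
  qed

  \<comment> \<open>The first summand covers the turns before the averaging move is available, when
    the radius is at least \<open>min r (\<theta> * R)\<close>. The second solves the recursion
    \<open>\<eta> * P + G * (\<delta> / 4) powr - s = P * \<theta> powr s\<close> of a later
    turn.\<close>
  define P where "P r = G * t 0 powr - s / (min r (\<theta> * R)) powr s + G * (\<delta> / 4) powr - s / (\<theta> powr s - \<eta>)" for r
  \<comment> \<open>The bound \<open>\<delta> / 4\<close> is for the uniqueness of the target point.
    The other bound, together with \<open>late\<close> and \<open>a_ge\<close>, yields the margin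
    required in \<open>V\<close>.\<close>
  define \<kappa> where "\<kappa> r = min (\<delta> / 4) (\<alpha> * P r powr (- 1 / s) / 2)" for r
  have P_pos: "0 < P r" if "0 < r" for r
    unfolding P_def using G \<theta>s \<theta> R t0[of 0] that \<delta>
    by (intro add_pos_pos divide_pos_pos mult_pos_pos) (auto simp: min_def)
  have P_start: "\<Psi> \<kappa>' w \<le> P r * snd w powr s" if r: "0 < r" and w: "min r (\<theta> * R) \<le> snd w" for r \<kappa>' w
  proof -
    define m where "m = min r (\<theta> * R)"
    have m: "0 < m"
      using r \<theta> R by (simp add: m_def)
    have "\<Psi> \<kappa>' w \<le> G * t 0 powr - s"
      unfolding \<Psi>_def using t_ge U_fin[of w] t0 m w by (intro sum_le) (auto simp: m_def)
    also have "\<dots> = G * t 0 powr - s / m powr s * m powr s"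
      using m by simp
    also have "\<dots> \<le> P r * snd w powr s"
    proof (rule mult_mono)
      have "0 \<le> G * (\<delta> / 4) powr - s / (\<theta> powr s - \<eta>)"
        using G \<theta>s by simp
      then show "G * t 0 powr - s / m powr s \<le> P r"
        by (simp add: P_def m_def)
      show "m powr s \<le> snd w powr s"
        using m w s by (intro powr_mono2) (auto simp: m_def)
    qed (use P_pos[OF r] in auto)
    finally show ?thesis .
  qed
  have P_step: "\<eta> * P r + G * (\<delta> / 4) powr - s \<le> P r * \<theta> powr s" if r: "0 < r" for r
  proof -
    have "0 \<le> G * t 0 powr - s / (min r (\<theta> * R)) powr s"
      using G by simp
    then have "G * (\<delta> / 4) powr - s / (\<theta> powr s - \<eta>) \<le> P r"
      by (simp add: P_def)
    then show ?thesis
      using \<theta>s by (simp add: divide_le_eq algebra_simps)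
  qed
  \<comment> \<open>A single weight is at most the whole potential. Solving
    \<open>t k powr - s \<le> P r * snd w powr s\<close> for \<open>t k * snd w\<close> gives the
    bound.\<close>
  have late: "P r powr (- 1 / s) \<le> t k * snd w"
    if r: "0 < r" and w: "0 < snd w" and inv: "\<Psi> \<kappa>' w \<le> P r * snd w powr s" and k: "k \<in> U \<kappa>' w" for r \<kappa>' w k
  proof -
    have "t k powr - s \<le> \<Psi> \<kappa>' w"
      unfolding \<Psi>_def using k U_fin[OF w] by (intro member_le_sum) auto
    then have "t k powr - s \<le> P r * snd w powr s"
      using inv by simp
    then have "(t k * snd w) powr - s \<le> P r"
      using w t0[of k] by (simp add: powr_mult powr_minus field_simps)
    then have "P r powr (- 1 / s) \<le> ((t k * snd w) powr - s) powr (- 1 / s)"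
      using s w t0[of k] by (intro powr_mono2') auto
    then show ?thesis
      using s w t0[of k] by (simp add: powr_powr)
  qed

  have "\<exists>f. \<forall>r w. fst w \<in> K \<longrightarrow> 0 < snd w \<longrightarrow> alice_legal \<alpha> K w (f r w) \<and>
      (snd w < R \<longrightarrow> (\<Sum>k\<in>V (\<kappa> r) w (f r w). t k powr - s) \<le> \<eta> * \<Psi> (\<kappa> r) w)"
  proof -
    have "\<forall>r w. \<exists>w'. fst w \<in> K \<longrightarrow> 0 < snd w \<longrightarrow> alice_legal \<alpha> K w w' \<and>
      (snd w < R \<longrightarrow> (\<Sum>k\<in>V (\<kappa> r) w w'. t k powr - s) \<le> \<eta> * \<Psi> (\<kappa> r) w)"
    proof (intro allI)
      fix r w
      have "\<kappa> r \<le> \<delta> / 4"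
        by (simp add: \<kappa>_def)
      then show "\<exists>w'. fst w \<in> K \<longrightarrow> 0 < snd w \<longrightarrow> alice_legal \<alpha> K w w' \<and>
        (snd w < R \<longrightarrow> (\<Sum>k\<in>V (\<kappa> r) w w'. t k powr - s) \<le> \<eta> * \<Psi> (\<kappa> r) w)"
        using move[of w "\<kappa> r"] by blast
    qed
    then show ?thesis by metis
  qed
  then obtain f where legal: "\<And>r w. fst w \<in> K \<Longrightarrow> 0 < snd w \<Longrightarrow> alice_legal \<alpha> K w (f r w)"
    and f: "\<And>r w. fst w \<in> K \<Longrightarrow> 0 < snd w \<Longrightarrow> snd w < R \<Longrightarrow>
      (\<Sum>k\<in>V (\<kappa> r) w (f r w). t k powr - s) \<le> \<eta> * \<Psi> (\<kappa> r) w"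
    by blast

  \<comment> \<open>Verification of the invariant and of the win\<close>
  show "ab_winning \<alpha> \<beta> (msupp \<mu>) (E_tilde M Z)"
    unfolding K_def[symmetric]
  proof (rule ab_winning_by_invariant[where f = f and I = "\<lambda>r w. \<Psi> (\<kappa> r) w \<le> P r * snd w powr s"])
    show "0 < \<alpha>" "0 < \<beta>"
      using \<alpha> \<beta> by auto
  next
    fix r :: real and w v
    assume r: "0 < r" and w: "fst w \<in> K" "0 < snd w" and inv: "\<Psi> (\<kappa> r) w \<le> P r * snd w powr s"
      and v: "fst v \<in> K" "snd v = \<alpha> * \<beta> * snd w" "ball_le v (f r w)"
    have v2: "snd v = \<theta> * snd w"
      using v(2) by (simp add: \<theta>_def)
    show "\<Psi> (\<kappa> r) v \<le> P r * snd v powr s"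
    proof (cases "snd w < R")
      \<comment> \<open>The radius of \<open>w\<close> is at least \<open>R\<close>, so that of
        \<open>v\<close> is at least \<open>\<theta> * R\<close> and the crude bound still
        applies.\<close>
      case False
      then show ?thesis
        using v2 \<theta> by (intro P_start[OF r]) (simp add: min.coboundedI2)
    next
      case True
      define \<rho> where "\<rho> = snd w"
      have \<rho>: "0 < \<rho>"
        using w by (simp add: \<rho>_def)
      \<comment> \<open>\<open>F\<close> contains the indices that come into range only now, for
        which \<open>t k * \<rho>\<close> exceeded \<open>\<delta> / 4\<close>. Lacunarity bounds
        their weight by a multiple of \<open>\<rho> powr s\<close>.\<close>
      define F where "F = {k \<in> U (\<kappa> r) v. \<delta> / 4 / \<rho> \<le> t k}"
      have vfin: "finite (U (\<kappa> r) v)"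
        using U_fin[of v] v2 \<theta> w by simp
      have sub: "cball (fst v) (snd v) \<subseteq> cball (fst (f r w)) (snd (f r w))"
        "cball (fst (f r w)) (snd (f r w)) \<subseteq> cball (fst w) (snd w)"
        using v(3) legal[OF w, of r] by (auto simp: ball_le_def alice_legal_def) (smt (verit) dist_triangle)+
      \<comment> \<open>An index outside \<open>F\<close> was already in range for \<open>w\<close>,
        and nested balls put it into \<open>U\<close> there. Then \<open>late\<close> supplies the
        margin, so it must be one that Alice's move failed to clear.\<close>
      have "U (\<kappa> r) v \<subseteq> V (\<kappa> r) w (f r w) \<union> F"
      proof
        fix k assume k: "k \<in> U (\<kappa> r) v"
        show "k \<in> V (\<kappa> r) w (f r w) \<union> F"
        proof (cases "\<delta> / 4 / \<rho> \<le> t k")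
          case False
          then have "t k * snd w \<le> \<delta> / 4"
            using \<rho> by (simp add: \<rho>_def field_simps)
          then have kw: "k \<in> U (\<kappa> r) w"
            using k sub unfolding U_def by blast
          have "\<kappa> r \<le> \<alpha> * P r powr (- 1 / s) / 2"
            by (simp add: \<kappa>_def)
          also have "\<dots> \<le> \<alpha> * (t k * snd w) / 2"
            using late[OF r w(2) inv kw] \<alpha> by simp
          also have "\<dots> \<le> \<alpha> * snd w * norm (a k)"
            using mult_left_mono[OF a_ge[of k], of "\<alpha> * snd w"] \<alpha> w by (simp add: mult_ac)
          finally show ?thesis
            using kw k sub(1) unfolding V_def U_def by blast
        qed (use k in \<open>simp add: F_def\<close>)
      qed
      moreover have "finite (V (\<kappa> r) w (f r w))" "finite F"
        using U_fin[OF w(2), of "\<kappa> r"] vfin by (auto simp: V_def F_def)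
      ultimately have "\<Psi> (\<kappa> r) v \<le> (\<Sum>k\<in>V (\<kappa> r) w (f r w) \<union> F. t k powr - s)"
        unfolding \<Psi>_def by (intro sum_mono2) auto
      also have "\<dots> \<le> (\<Sum>k\<in>V (\<kappa> r) w (f r w). t k powr - s) + (\<Sum>k\<in>F. t k powr - s)"
        using \<open>finite (V _ _ _)\<close> \<open>finite F\<close> by (simp add: sum_Un sum_nonneg)
      also have "\<dots> \<le> \<eta> * \<Psi> (\<kappa> r) w + G * (\<delta> / 4 / \<rho>) powr - s"
        using f[OF w True, of r] \<open>finite F\<close> \<delta> \<rho> by (intro add_mono sum_le) (auto simp: F_def)
      also have "\<dots> \<le> \<eta> * (P r * \<rho> powr s) + G * (\<delta> / 4 / \<rho>) powr - s"
        using inv \<eta> by (simp add: \<rho>_def)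
      also have "\<dots> = (\<eta> * P r + G * (\<delta> / 4) powr - s) * \<rho> powr s"
        using \<delta> \<rho> by (simp add: powr_divide powr_mult powr_minus field_simps)
      also have "\<dots> \<le> (P r * \<theta> powr s) * \<rho> powr s"
        using P_step[OF r] by (intro mult_right_mono) auto
      also have "\<dots> = P r * snd v powr s"
        using \<theta> \<rho> by (simp add: v2 \<rho>_def powr_mult)
      finally show ?thesis .
    qed
  next
    fix r b y
    assume r: "0 < r" and inv: "\<And>k. \<Psi> (\<kappa> r) (b k) \<le> P r * snd (b k) powr s"
      and rad: "\<And>k. snd (b k) = r * (\<alpha> * \<beta>) ^ k" and y: "\<And>k. dist (fst (b k)) y \<le> snd (b k)"
    have "\<kappa> r \<le> dist (M k *v y) z" if z: "z \<in> Z k" for k z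
    proof -
      \<comment> \<open>Once the radius is this small, \<open>k\<close> is in range but violates the
        lower bound \<open>late\<close>, so it cannot belong to \<open>U\<close>. Hence the whole
        ball, and with it \<open>y\<close>, keeps distance \<open>\<kappa> r\<close> from
        \<open>Z k\<close>; this bound does not depend on \<open>k\<close>.\<close>
      define e where "e = min (\<delta> / 4) (P r powr (- 1 / s)) / (t k * r)"
      have e: "0 < e"
        using \<delta> P_pos[OF r] t0[of k] r by (simp add: e_def)
      obtain i where "\<theta> ^ i < e"
        using real_arch_pow_inv[OF e \<theta>(2)] by blast
      then have "t k * snd (b i) < min (\<delta> / 4) (P r powr (- 1 / s))"
        using t0[of k] r by (simp add: e_def rad \<theta>_def field_simps)
      moreover have "0 < snd (b i)"
        using r \<theta> by (simp add: rad \<theta>_def)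
      ultimately have "k \<notin> U (\<kappa> r) (b i)" "t k * snd (b i) \<le> \<delta> / 4"
        using late[OF r _ inv, of i k] by auto
      then show ?thesis
        using z y[of i] unfolding U_def by (force simp: not_less)
    qed
    moreover have "0 < \<kappa> r"
      using \<delta> \<alpha> P_pos[OF r] by (simp add: \<kappa>_def)
    ultimately show "y \<in> E_tilde M Z"
      unfolding E_tilde_def by blast
  qed (use legal P_start in auto)
qed

end
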